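(* Let $h\colon[n]\to[n]$ be a Hessenberg function. If $u\prec_h v$ in $\mathfrak S_n$, then there exist $v_0,\dots,v_k\in\mathfrak S_n$ with $\ell(v_i)=\ell(u)+i$ for $0\le i\le k$ and $u=v_0\prec_h v_1\prec_h\cdots\prec_h v_k=v$.
   Context: A Hessenberg function is a nondecreasing $h\colon[n]\to[n]$ with $h(i)\ge i$. For $u\in\mathfrak S_n$ (one-line notation) and $i<j$, $u(i,j)$ is obtained from $u$ by swapping the entries in positions $i$ and $j$; $\ell(u)$ is the number of inversions of $u$. The $h$-Bruhat order is the transitive closure of the relation $u\prec_h u(i,j)$ whenever $i<j\le h(i)$ and $\ell(u(i,j))>\ell(u)$. *)

theory Defs
  imports "HOL-Combinatorics.Combinatorics"
begin

definition hessenberg :: "nat \<Rightarrow> (nat \<Rightarrow> nat) \<Rightarrow> bool" where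
  "hessenberg n h \<longleftrightarrow>
     h \<in> {1..n} \<rightarrow> {1..n} \<and> mono_on {1..n} h \<and> (\<forall>i\<in>{1..n}. i \<le> h i)"

definition perm_length :: "nat \<Rightarrow> (nat \<Rightarrow> nat) \<Rightarrow> nat" where
  "perm_length n u = card {(i, j). i \<in> {1..n} \<and> j \<in> {1..n} \<and> i < j \<and> u i > u j}"

(* The one-line notation of u is u 1, ..., u n, so swapping the entries in positions
   i and j is composition with the transposition on the right. *)
definition swap_positions :: "(nat \<Rightarrow> nat) \<Rightarrow> nat \<Rightarrow> nat \<Rightarrow> (nat \<Rightarrow> nat)" where
  "swap_positions u i j = u \<circ> transpose i j"

definition hbruhat_step ::
  "nat \<Rightarrow> (nat \<Rightarrow> nat) \<Rightarrow> (nat \<Rightarrow> nat) \<Rightarrow> (nat \<Rightarrow> nat) \<Rightarrow> bool" where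
  "hbruhat_step n h u v \<longleftrightarrow>
     u permutes {1..n} \<and>
     (\<exists>i\<in>{1..n}. \<exists>j\<in>{1..n}. i < j \<and> j \<le> h i \<and> v = swap_positions u i j \<and>
        perm_length n v > perm_length n u)"

(* The strict order: every generating step increases the length, so the transitive closure
   is irreflexive. *)
definition hbruhat ::
  "nat \<Rightarrow> (nat \<Rightarrow> nat) \<Rightarrow> (nat \<Rightarrow> nat) \<Rightarrow> (nat \<Rightarrow> nat) \<Rightarrow> bool" where
  "hbruhat n h = (hbruhat_step n h)\<^sup>+\<^sup>+"

end

theory Submission
  imports Defs
begin

text \<open>A generating step swaps values \<open>a < c\<close> in positions \<open>i < j\<close>. If no position between
  \<open>i\<close> and \<open>j\<close> carries a value between \<open>a\<close> and \<open>c\<close>, the length grows by exactly one. Otherwise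
  pick such a position \<open>m\<close> with value \<open>b\<close> and pass through
  \<open>abc, bac, bca, cba\<close>, swapping positions \<open>(i,m)\<close>, \<open>(m,j)\<close>, \<open>(i,m)\<close>; these swaps are allowed
  because \<open>m < j \<le> h i \<le> h m\<close>, and they are shorter, so induction on \<open>j - i\<close> applies.\<close>

definition inversions :: "nat \<Rightarrow> (nat \<Rightarrow> nat) \<Rightarrow> (nat \<times> nat) set" where
  "inversions n u = {(i, j). i \<in> {1..n} \<and> j \<in> {1..n} \<and> i < j \<and> u i > u j}"

lemma finite_inversions [simp]: "finite (inversions n u)"
  by (rule finite_subset[of _ "{1..n} \<times> {1..n}"]) (auto simp: inversions_def)

lemma swap_positions_permutes:
  assumes "u permutes {1..n}" "i \<in> {1..n}" "j \<in> {1..n}"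
  shows "swap_positions u i j permutes {1..n}"
  unfolding swap_positions_def using assms by (metis permutes_compose permutes_swap_id)

lemma perm_length_swap_adjacent_values:
  assumes u: "u permutes {1..n}" and ij: "i \<in> {1..n}" "j \<in> {1..n}" "i < j" and less: "u i < u j"
    and none: "\<And>m. i < m \<Longrightarrow> m < j \<Longrightarrow> \<not> (u i < u m \<and> u m < u j)"
  shows "perm_length n (swap_positions u i j) = Suc (perm_length n u)"
proof -
  let ?t = "transpose i j" and ?v = "swap_positions u i j"
  let ?f = "\<lambda>(p, q). if ?t p < ?t q then (?t p, ?t q) else (p, q)"
  \<comment> \<open>\<open>?f\<close> matches inversions of \<open>u\<close> and \<open>?v\<close>. The pairs whose order \<open>?t\<close> reverses are \<open>(i, j)\<close>
    and those joining \<open>i\<close> or \<open>j\<close> to a position in between; by \<open>none\<close> the latter are inversions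
    of both or of neither.\<close>
  have inj: "u p = u q \<longleftrightarrow> p = q" for p q
    using permutes_inj[OF u] by (auto dest: injD)
  have none': "u m < u i \<or> u j < u m" if "i < m" "m < j" for m
    using none[OF that] inj[of m i] inj[of m j] that by linarith
  have mem: "?t p \<in> {1..n} \<longleftrightarrow> p \<in> {1..n}" for p
    using ij by (auto simp: transpose_def)
  have reversed: "u p > u q \<longleftrightarrow> ?v p > ?v q"
    if pq: "p < q" "\<not> ?t p < ?t q" "(p, q) \<noteq> (i, j)" for p q
  proof -
    consider "p = i" "i < q" "q < j" | "q = j" "i < p" "p < j"
      using pq ij by (auto simp: transpose_def split: if_splits)
    then show ?thesis
      using none'[of q] none'[of p] less ij
      by cases (auto simp: swap_positions_def transpose_def)
  qed
  \<comment> \<open>The map is its own inverse on pairs with \<open>p < q\<close>: a pair moved by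
    \<open>?t\<close> is moved back by \<open>?t\<close>, and every other pair is fixed. So
    \<open>?f\<close> serves in both directions below.\<close>
  have invol: "?f (?f a) = a" if "a \<in> inversions n w" for a w
    using that by (cases a) (simp add: inversions_def)
  \<comment> \<open>The removed pair \<open>(i, j)\<close> is inverted in \<open>?v\<close> but not
    in \<open>u\<close>, because \<open>u i < u j\<close>; it is the one inversion gained.\<close>
  have "bij_betw ?f (inversions n u) (inversions n ?v - {(i, j)})"
  proof (rule bij_betw_byWitness[where f' = ?f])
    show "\<forall>a\<in>inversions n u. ?f (?f a) = a" "\<forall>a\<in>inversions n ?v - {(i, j)}. ?f (?f a) = a"
      using invol by blast+
    show "?f ` inversions n u \<subseteq> inversions n ?v - {(i, j)}"
    proof (intro image_subsetI)
      fix a assume "a \<in> inversions n u"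
      then obtain p q where a: "a = (p, q)" "p \<in> {1..n}" "q \<in> {1..n}" "p < q" "u p > u q"
        by (auto simp: inversions_def)
      have ne: "(p, q) \<noteq> (i, j)" using a less by auto
      show "?f a \<in> inversions n ?v - {(i, j)}"
      proof (cases "?t p < ?t q")
        case True
        \<comment> \<open>Equality would force \<open>p = j\<close> and \<open>q = i\<close>,
          against \<open>p < q\<close>. The moved pair is inverted in \<open>?v\<close> because
          \<open>?v (?t p) = u p\<close>.\<close>
        then have "(?t p, ?t q) \<noteq> (i, j)"
          using \<open>p < q\<close> \<open>i < j\<close> by (simp add: transpose_def)
        then show ?thesis using True a mem[of p] mem[of q]
          by (auto simp: inversions_def swap_positions_def)
      next
        case False
        then show ?thesis using a reversed[OF \<open>p < q\<close> False ne] ne by (auto simp: inversions_def)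
      qed
    qed
    show "?f ` (inversions n ?v - {(i, j)}) \<subseteq> inversions n u"
    proof (intro image_subsetI)
      fix a assume "a \<in> inversions n ?v - {(i, j)}"
      then obtain p q where a: "a = (p, q)" "p \<in> {1..n}" "q \<in> {1..n}" "p < q" "?v p > ?v q"
        and ne: "(p, q) \<noteq> (i, j)"
        by (auto simp: inversions_def)
      show "?f a \<in> inversions n u"
      proof (cases "?t p < ?t q")
        case True
        then show ?thesis using a mem[of p] mem[of q] by (auto simp: inversions_def swap_positions_def)
      next
        case False
        then show ?thesis using a reversed[OF \<open>p < q\<close> False ne] by (auto simp: inversions_def)
      qed
    qed
  qed
  then have "card (inversions n u) = card (inversions n ?v - {(i, j)})"
    by (rule bij_betw_same_card)
  moreover have "(i, j) \<in> inversions n ?v"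
    using ij less by (simp add: inversions_def swap_positions_def)
  ultimately show ?thesis
    using card_Suc_Diff1[OF finite_inversions, of "(i, j)" n ?v]
    unfolding perm_length_def inversions_def[symmetric] by simp
qed

text \<open>Such a step cannot be refined within the order, since every generating step raises the
  length by at least one.\<close>

definition hbruhat_cover :: "nat \<Rightarrow> (nat \<Rightarrow> nat) \<Rightarrow> (nat \<Rightarrow> nat) \<Rightarrow> (nat \<Rightarrow> nat) \<Rightarrow> bool" where
  "hbruhat_cover n h u v \<longleftrightarrow> hbruhat_step n h u v \<and> perm_length n v = Suc (perm_length n u)"

lemma hbruhat_step_permutes:
  "hbruhat_step n h u v \<Longrightarrow> v permutes {1..n}"
  unfolding hbruhat_step_def by (blast intro: swap_positions_permutes)

text \<open>This is the conjugation identity (i m)(m j)(i m) = (i j).\<close>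

lemma swap_positions_via:
  assumes "i \<noteq> m" "m \<noteq> j" "i \<noteq> j"
  shows "swap_positions (swap_positions (swap_positions u i m) m j) i m = swap_positions u i j"
  using assms by (auto simp: swap_positions_def transpose_def fun_eq_iff)

text \<open>Assuming an ascent of values rather than a growth in length lets the induction
  hypothesis apply to the intermediate permutations by comparing two entries, without counting
  inversions.\<close>

lemma swap_ascent_cover_chain:
  assumes h: "hessenberg n h"
  shows "\<lbrakk>u permutes {1..n}; i \<in> {1..n}; j \<in> {1..n}; i < j; j \<le> h i; u i < u j\<rbrakk>
    \<Longrightarrow> (hbruhat_cover n h)\<^sup>+\<^sup>+ u (swap_positions u i j)"
proof (induction "j - i" arbitrary: u i j rule: less_induct)
  case less
  show ?case
  proof (cases "\<exists>m. i < m \<and> m < j \<and> u i < u m \<and> u m < u j")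
    case False
    then have "perm_length n (swap_positions u i j) = Suc (perm_length n u)"
      using less.prems by (intro perm_length_swap_adjacent_values) auto
    then have "hbruhat_cover n h u (swap_positions u i j)"
      using less.prems unfolding hbruhat_cover_def hbruhat_step_def by (metis lessI)
    then show ?thesis by blast
  next
    case True
    then obtain m where m: "i < m" "m < j" "u i < u m" "u m < u j" by blast
    have mn: "m \<in> {1..n}" using m less.prems by auto
    have "h i \<le> h m"
      using h m mn less.prems by (auto simp: hessenberg_def intro: mono_onD)
    then have hm: "j \<le> h m" "m \<le> h i" using less.prems m by auto
    let ?v = "swap_positions u i m"
    let ?w = "swap_positions ?v m j"
    have v: "?v permutes {1..n}"
      using less.prems(1,2) mn by (rule swap_positions_permutes)
    then have w: "?w permutes {1..n}"
      using mn less.prems(3) by (rule swap_positions_permutes)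
    have "(hbruhat_cover n h)\<^sup>+\<^sup>+ u ?v"
      using less.hyps[of m i u] less.prems m mn hm by auto
    moreover have "(hbruhat_cover n h)\<^sup>+\<^sup>+ ?v ?w"
    proof (rule less.hyps)
      show "?v m < ?v j" using m less.prems by (simp add: swap_positions_def)
    qed (use less.prems m mn hm v in auto)
    moreover have "(hbruhat_cover n h)\<^sup>+\<^sup>+ ?w (swap_positions ?w i m)"
    proof (rule less.hyps)
      have "?w i = u m" "?w m = u j"
        using m by (simp_all add: swap_positions_def transpose_apply_other)
      then show "?w i < ?w m" using m by simp
    qed (use less.prems m mn hm w in auto)
    moreover have "swap_positions ?w i m = swap_positions u i j"
      using m by (intro swap_positions_via) auto
    ultimately show ?thesis by (metis tranclp_trans)
  qed
qed

lemma hbruhat_cover_chain_less: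
  "(hbruhat_cover n h)\<^sup>+\<^sup>+ u v \<Longrightarrow> perm_length n u < perm_length n v"
  by (induction rule: tranclp_induct) (auto simp: hbruhat_cover_def)

lemma hbruhat_step_cover_chain:
  assumes h: "hessenberg n h" and step: "hbruhat_step n h u v"
  shows "(hbruhat_cover n h)\<^sup>+\<^sup>+ u v"
proof -
  obtain i j where u: "u permutes {1..n}" and ij: "i \<in> {1..n}" "j \<in> {1..n}" "i < j" "j \<le> h i"
    and v: "v = swap_positions u i j" and len: "perm_length n u < perm_length n v"
    using step by (auto simp: hbruhat_step_def)
  \<comment> \<open>A descent of \<open>u\<close> at these positions would be an ascent of
    \<open>v\<close>. Swapping back would then give a cover chain from \<open>v\<close> up to
    \<open>u\<close>, making \<open>u\<close> longer than \<open>v\<close>.\<close>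
  have "u i < u j"
  proof (rule ccontr)
    assume "\<not> u i < u j"
    moreover have "u i \<noteq> u j" using permutes_inj[OF u] ij by (auto dest: injD)
    ultimately have "v i < v j" by (simp add: v swap_positions_def)
    then have "(hbruhat_cover n h)\<^sup>+\<^sup>+ v (swap_positions v i j)"
      using h ij hbruhat_step_permutes[OF step] by (intro swap_ascent_cover_chain) auto
    moreover have "swap_positions v i j = u"
      by (simp add: v swap_positions_def comp_assoc)
    ultimately show False using hbruhat_cover_chain_less len by fastforce
  qed
  then show ?thesis unfolding v using h u ij by (intro swap_ascent_cover_chain)
qed

theorem theorem3p5:
  fixes n :: nat and h u v :: "nat \<Rightarrow> nat"
  assumes "hessenberg n h"
    and "u permutes {1..n}" and "v permutes {1..n}"
    and "hbruhat n h u v"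
  shows "\<exists>(k::nat) (w :: nat \<Rightarrow> nat \<Rightarrow> nat).
    (\<forall>i\<le>k. w i permutes {1..n} \<and> perm_length n (w i) = perm_length n u + i) \<and>
    w 0 = u \<and> w k = v \<and> (\<forall>i<k. hbruhat n h (w i) (w (Suc i)))"
proof -
  have "(hbruhat_step n h)\<^sup>+\<^sup>+ u v" using assms by (simp add: hbruhat_def)
  \<comment> \<open>Each generating step is replaced by its own chain of covers, and the chains are
    concatenated.\<close>
  then have "(hbruhat_cover n h)\<^sup>+\<^sup>+ u v"
    by (induction rule: tranclp_induct)
      (blast intro: hbruhat_step_cover_chain[OF assms(1)] tranclp_trans)+
  \<comment> \<open>Here \<open>k\<close> counts the covers in the chain and \<open>w\<close> lists
    its vertices; as each cover adds one to the length, \<open>w i\<close> has length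
    \<open>perm_length n u + i\<close>.\<close>
  then obtain k where "(hbruhat_cover n h ^^ k) u v"
    by (auto simp: tranclp_power)
  then obtain w where w: "w 0 = u" "w k = v" "\<And>i. i < k \<Longrightarrow> hbruhat_cover n h (w i) (w (Suc i))"
    by (auto simp: relpowp_fun_conv)
  have "w i permutes {1..n} \<and> perm_length n (w i) = perm_length n u + i" if "i \<le> k" for i
    using that
  proof (induction i)
    case 0
    then show ?case using w(1) assms(2) by simp
  next
    case (Suc i)
    then show ?case
      using w(3)[of i] hbruhat_step_permutes by (auto simp: hbruhat_cover_def)
  qed
  moreover have "hbruhat n h (w i) (w (Suc i))" if "i < k" for i
    using w(3)[OF that] by (auto simp: hbruhat_def hbruhat_cover_def)
  ultimately show ?thesis using w(1,2) by blast
qed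

end
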